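(* If $\gamma>0$, then for any real constants $a=(a_e)_{e\in E}$ the weighted bond magnetization $m(\sigma)=\sum_{e\in E}a_ef_e(\sigma)$ satisfies $$\mathbb{E}\Bigl\langle\bigl(m(\sigma)-\langle m(\sigma)\rangle\bigr)^2\Bigr\rangle\leq\frac{1}{\gamma}\|a\|_2\|a\|_1.$$
   Context: Let $(\Sigma,\mathcal{F})$ be a measurable space, $E$ a fixed finite index set, $(f_e)_{e\in E}$ a family of measurable functions $f_e:\Sigma\to[-1,1]$, and $(g_e)_{e\in E}$ i.i.d. standard Gaussian random variables. Let $$Y(\sigma)=\sum_{e\in E}g_ef_e(\sigma),\qquad dG(\sigma)=\frac{\exp(\gamma Y(\sigma))}{Z}\,d\mu(\sigma),$$ where $\gamma>0$ is a constant, $\mu$ is a (possibly random) finite nonzero measure on $(\Sigma,\mathcal{F})$, and $Z$ is the normalizing constant making the Gibbs measure $G$ a probability measure. The functions $f_e$ may also be random; all the randomness of $(f_e)_{e\in E}$ and $\mu$ is independent of $(g_e)_{e\in E}$. The bracket $\langle\,\cdot\,\rangle$ denotes the average with respect to $G$ (for fixed disorder), and $\mathbb{E}$ the expectation over all the disorder. Notation: $\|a\|_2=(\sum_{e\in E}a_e^2)^{1/2}$ and $\|a\|_1=\sum_{e\in E}|a_e|$. *)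

theory Defs
  imports "HOL-Probability.Probability"
begin

definition gaussian_field ::
  "'e set \<Rightarrow> ('e \<Rightarrow> real) \<Rightarrow> ('e \<Rightarrow> 's \<Rightarrow> real) \<Rightarrow> 's \<Rightarrow> real"
  where "gaussian_field E g f \<sigma> = (\<Sum>e\<in>E. g e * f e \<sigma>)"

definition partition_fun :: "real \<Rightarrow> 's measure \<Rightarrow> ('s \<Rightarrow> real) \<Rightarrow> real"
  where "partition_fun \<gamma> \<mu> Y = (\<integral>\<sigma>. exp (\<gamma> * Y \<sigma>) \<partial>\<mu>)"

definition gibbs_measure :: "real \<Rightarrow> 's measure \<Rightarrow> ('s \<Rightarrow> real) \<Rightarrow> 's measure"
  where "gibbs_measure \<gamma> \<mu> Y =
    density \<mu> (\<lambda>\<sigma>. ennreal (exp (\<gamma> * Y \<sigma>) / partition_fun \<gamma> \<mu> Y))"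

definition bond_magnetization ::
  "'e set \<Rightarrow> ('e \<Rightarrow> real) \<Rightarrow> ('e \<Rightarrow> 's \<Rightarrow> real) \<Rightarrow> 's \<Rightarrow> real"
  where "bond_magnetization E a f \<sigma> = (\<Sum>e\<in>E. a e * f e \<sigma>)"

end

theory Submission
  imports Defs "HOL-Real_Asymp.Real_Asymp"
begin

text \<open>
  Write \<open>\<langle>u\<rangle>\<close> for the Gibbs average as a function of the Gaussian vector \<open>g\<close>. Since
  \<open>\<partial>\<langle>m\<rangle> / \<partial>g\<^sub>e = \<gamma> (\<langle>m f\<^sub>e\<rangle> - \<langle>m\<rangle> \<langle>f\<^sub>e\<rangle>)\<close>, the Gibbs variance of \<open>m\<close> equals
  \<open>(1/\<gamma>) \<Sum>\<^sub>e a\<^sub>e \<partial>\<langle>m\<rangle> / \<partial>g\<^sub>e\<close>. Gaussian integration by parts turns its expectation, conditionally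
  on the remaining disorder, into \<open>(1/\<gamma>) E (\<Sum>\<^sub>e a\<^sub>e g\<^sub>e) \<langle>m\<rangle>\<close>. Here \<open>\<bar>\<langle>m\<rangle>\<bar> \<le> \<parallel>a\<parallel>\<^sub>1\<close>, while the linear
  form \<open>\<Sum>\<^sub>e a\<^sub>e g\<^sub>e\<close> has second moment \<open>\<parallel>a\<parallel>\<^sub>2\<^sup>2\<close>.
\<close>

section \<open>Averages tilted by an exponential weight\<close>

lemma (in finite_measure) integrable_mult_exp:
  fixes u H :: "'a \<Rightarrow> real"
  assumes [measurable]: "u \<in> borel_measurable M" "H \<in> borel_measurable M"
    and u: "\<And>x. x \<in> space M \<Longrightarrow> \<bar>u x\<bar> \<le> U" and H: "\<And>x. x \<in> space M \<Longrightarrow> \<bar>H x\<bar> \<le> K"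
  shows "integrable M (\<lambda>x. u x * exp (H x))"
proof (rule integrable_const_bound[where B="\<bar>U\<bar> * exp K"])
  have "norm (u x * exp (H x)) \<le> \<bar>U\<bar> * exp K" if "x \<in> space M" for x
    unfolding norm_mult using u[OF that] H[OF that] by (intro mult_mono) auto
  then show "AE x in M. norm (u x * exp (H x)) \<le> \<bar>U\<bar> * exp K" by (intro AE_I2)
qed measurable

text \<open>Boundedness of \<open>u\<close> and \<open>v\<close> makes the first-order Taylor
  remainder of the integrand quadratic in the increment \<open>h\<close>, uniformly in \<sigma>.
  Integrating against a finite measure keeps the factor \<open>h\<^sup>2\<close>, so the difference
  quotient converges with an error linear in \<open>h\<close>.\<close>

lemma has_real_derivative_integral_exp:
  fixes u v :: "'s \<Rightarrow> real"
  assumes "finite_measure \<mu>" and [measurable]: "u \<in> borel_measurable \<mu>" "v \<in> borel_measurable \<mu>"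
    and u: "\<And>\<sigma>. \<sigma> \<in> space \<mu> \<Longrightarrow> \<bar>u \<sigma>\<bar> \<le> U" and v: "\<And>\<sigma>. \<sigma> \<in> space \<mu> \<Longrightarrow> \<bar>v \<sigma>\<bar> \<le> V"
  shows "((\<lambda>t. \<integral>\<sigma>. u \<sigma> * exp (t * v \<sigma>) \<partial>\<mu>) has_real_derivative
    (\<integral>\<sigma>. u \<sigma> * v \<sigma> * exp (t * v \<sigma>) \<partial>\<mu>)) (at t)"
proof -
  interpret finite_measure \<mu> by fact
  define F where "F t = (\<integral>\<sigma>. u \<sigma> * exp (t * v \<sigma>) \<partial>\<mu>)" for t
  define F' where "F' = (\<integral>\<sigma>. u \<sigma> * v \<sigma> * exp (t * v \<sigma>) \<partial>\<mu>)"
  \<comment> \<open>The three factors bound \<open>u\<close>, the exponential at the base point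
    \<open>t\<close>, and the Taylor coefficient of \<open>exp (h * v \<sigma>)\<close> for
    increments with \<open>\<bar>h\<bar> \<le> 1\<close>.\<close>
  define C where "C = \<bar>U\<bar> * exp (\<bar>t\<bar> * \<bar>V\<bar>) * (exp \<bar>V\<bar> * V\<^sup>2)"
  have sv: "\<bar>s * v \<sigma>\<bar> \<le> \<bar>s\<bar> * \<bar>V\<bar>" if "\<sigma> \<in> space \<mu>" for \<sigma> s
    unfolding abs_mult using v[OF that] by (intro mult_left_mono) auto
  then have E: "exp (s * v \<sigma>) \<le> exp (\<bar>s\<bar> * \<bar>V\<bar>)" if "\<sigma> \<in> space \<mu>" for \<sigma> s
    using that by (meson abs_le_D1 exp_le_cancel_iff)
  have int1: "integrable \<mu> (\<lambda>\<sigma>. u \<sigma> * exp (s * v \<sigma>))" for s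
    using u sv by (intro integrable_mult_exp) auto
  have int2: "integrable \<mu> (\<lambda>\<sigma>. u \<sigma> * v \<sigma> * exp (s * v \<sigma>))" for s
  proof (rule integrable_mult_exp)
    show "\<bar>u \<sigma> * v \<sigma>\<bar> \<le> \<bar>U\<bar> * \<bar>V\<bar>" if "\<sigma> \<in> space \<mu>" for \<sigma>
      unfolding abs_mult using u[OF that] v[OF that] by (intro mult_mono) auto
  qed (use sv in auto)
  have rem: "\<bar>F (t + h) - F t - h * F'\<bar> \<le> h\<^sup>2 * (C * measure \<mu> (space \<mu>))" if h: "\<bar>h\<bar> \<le> 1" for h
  proof -
    have pt: "\<bar>u \<sigma> * exp ((t + h) * v \<sigma>) - u \<sigma> * exp (t * v \<sigma>) - h * (u \<sigma> * v \<sigma> * exp (t * v \<sigma>))\<bar>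
        \<le> h\<^sup>2 * C" if \<sigma>: "\<sigma> \<in> space \<mu>" for \<sigma>
    proof -
      have hv: "\<bar>h * v \<sigma>\<bar> \<le> \<bar>h\<bar> * \<bar>V\<bar>"
        using v[OF \<sigma>] by (simp add: abs_mult mult_left_mono)
      \<comment> \<open>The restriction to \<open>\<bar>h\<bar> \<le> 1\<close> enters here: it
        frees the exponential in the remainder from \<open>h\<close>, so that \<open>C\<close> is
        one constant for all small increments.\<close>
      have hv1: "\<bar>h * v \<sigma>\<bar> \<le> \<bar>V\<bar>"
        using hv mult_right_mono[OF h, of "\<bar>V\<bar>"] by simp
      have "\<bar>exp (h * v \<sigma>) - (1 + h * v \<sigma>)\<bar> \<le> exp \<bar>h * v \<sigma>\<bar> * \<bar>h * v \<sigma>\<bar>\<^sup>2"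
        using Taylor_exp_field[of "h * v \<sigma>" 1] by (simp add: power2_eq_square)
      also have "\<dots> \<le> exp \<bar>V\<bar> * (\<bar>h\<bar> * \<bar>V\<bar>)\<^sup>2"
        using hv hv1 by (intro mult_mono power_mono) auto
      also have "\<dots> = h\<^sup>2 * (exp \<bar>V\<bar> * V\<^sup>2)" by (simp add: power_mult_distrib)
      finally have R: "\<bar>exp (h * v \<sigma>) - (1 + h * v \<sigma>)\<bar> \<le> h\<^sup>2 * (exp \<bar>V\<bar> * V\<^sup>2)" .
      have "u \<sigma> * exp ((t + h) * v \<sigma>) - u \<sigma> * exp (t * v \<sigma>) - h * (u \<sigma> * v \<sigma> * exp (t * v \<sigma>))
          = u \<sigma> * exp (t * v \<sigma>) * (exp (h * v \<sigma>) - (1 + h * v \<sigma>))"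
        by (simp add: exp_add algebra_simps)
      also have "\<bar>\<dots>\<bar> \<le> (\<bar>U\<bar> * exp (\<bar>t\<bar> * \<bar>V\<bar>)) * (h\<^sup>2 * (exp \<bar>V\<bar> * V\<^sup>2))"
        unfolding abs_mult using R E[OF \<sigma>] u[OF \<sigma>] by (intro mult_mono) auto
      finally show ?thesis by (simp add: C_def algebra_simps)
    qed
    have "F (t + h) - F t - h * F' = (\<integral>\<sigma>. u \<sigma> * exp ((t + h) * v \<sigma>) - u \<sigma> * exp (t * v \<sigma>)
        - h * (u \<sigma> * v \<sigma> * exp (t * v \<sigma>)) \<partial>\<mu>)"
      unfolding F_def F'_def using int1 int2 by simp
    also have "\<bar>\<dots>\<bar> \<le> (\<integral>\<sigma>. h\<^sup>2 * C \<partial>\<mu>)"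
      using pt int1 int2
      by (intro order_trans[OF integral_abs_bound] integral_mono integrable_abs
          Bochner_Integration.integrable_diff integrable_mult_right) auto
    finally show ?thesis by (simp add: mult_ac)
  qed
  define K where "K = C * measure \<mu> (space \<mu>)"
  have "((\<lambda>h. (F (t + h) - F t) / h - F') \<longlongrightarrow> 0) (at 0)"
  proof (rule Lim_null_comparison)
    show "\<forall>\<^sub>F h in at 0. norm ((F (t + h) - F t) / h - F') \<le> \<bar>h\<bar> * K"
      unfolding eventually_at
    proof (intro exI[of _ 1] conjI ballI impI)
      fix h :: real assume "h \<noteq> 0 \<and> dist h 0 < 1"
      then have h: "h \<noteq> 0" "\<bar>h\<bar> \<le> 1" by (auto simp: dist_real_def)
      have "\<bar>(F (t + h) - F t) / h - F'\<bar> = \<bar>F (t + h) - F t - h * F'\<bar> / \<bar>h\<bar>"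
        using h by (simp add: field_simps flip: abs_divide)
      also have "\<dots> \<le> h\<^sup>2 * K / \<bar>h\<bar>"
        using rem[OF h(2)] by (intro divide_right_mono) (auto simp: K_def)
      also have "\<dots> = \<bar>h\<bar> * K" using h by (simp add: field_simps power2_eq_square flip: abs_mult)
      finally show "norm ((F (t + h) - F t) / h - F') \<le> \<bar>h\<bar> * K" by simp
    qed auto
    show "((\<lambda>h. \<bar>h\<bar> * K) \<longlongrightarrow> 0) (at 0)" by (auto intro!: tendsto_eq_intros)
  qed
  then have "(F has_real_derivative F') (at t)"
    unfolding DERIV_def using LIM_zero_iff by blast
  then show ?thesis by (simp add: F_def[abs_def] F'_def)
qed

text \<open>Integrability and differentiability need only some bound, so the constant is hidden
  behind an existential and the closure rules below can discharge such goals; the bounds that enter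
  the final estimate are tracked explicitly. Boundedness is asked on \<open>space M\<close> only,
  because the \<open>f e\<close> are controlled only there.\<close>

definition bounded_borel :: "'a measure \<Rightarrow> ('a \<Rightarrow> real) \<Rightarrow> bool"
  where "bounded_borel M u \<longleftrightarrow> u \<in> borel_measurable M \<and> (\<exists>B. \<forall>x\<in>space M. \<bar>u x\<bar> \<le> B)"

lemma bounded_borelI:
  "u \<in> borel_measurable M \<Longrightarrow> (\<And>x. x \<in> space M \<Longrightarrow> \<bar>u x\<bar> \<le> B) \<Longrightarrow> bounded_borel M u"
  by (auto simp: bounded_borel_def)

lemma bounded_borelE:
  assumes "bounded_borel M u"
  obtains B where "u \<in> borel_measurable M" "\<And>x. x \<in> space M \<Longrightarrow> \<bar>u x\<bar> \<le> B"
  using assms by (auto simp: bounded_borel_def)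

lemma bounded_borel_measurable: "bounded_borel M u \<Longrightarrow> u \<in> borel_measurable M"
  by (simp add: bounded_borel_def)

lemma bounded_borel_const [simp]: "bounded_borel M (\<lambda>_. c)"
  by (rule bounded_borelI[where B="\<bar>c\<bar>"]) auto

lemma bounded_borel_add:
  assumes "bounded_borel M u" "bounded_borel M v"
  shows "bounded_borel M (\<lambda>x. u x + v x)"
proof -
  from assms obtain B C where "u \<in> borel_measurable M" "v \<in> borel_measurable M"
    and b: "\<And>x. x \<in> space M \<Longrightarrow> \<bar>u x\<bar> \<le> B" "\<And>x. x \<in> space M \<Longrightarrow> \<bar>v x\<bar> \<le> C"
    by (auto elim!: bounded_borelE)
  then show ?thesis
    by (intro bounded_borelI[where B="B + C"] borel_measurable_add order_trans[OF abs_triangle_ineq]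
        add_mono)
qed

lemma bounded_borel_mult:
  assumes "bounded_borel M u" "bounded_borel M v"
  shows "bounded_borel M (\<lambda>x. u x * v x)"
proof -
  from assms obtain B C where m: "u \<in> borel_measurable M" "v \<in> borel_measurable M"
    and b: "\<And>x. x \<in> space M \<Longrightarrow> \<bar>u x\<bar> \<le> B" "\<And>x. x \<in> space M \<Longrightarrow> \<bar>v x\<bar> \<le> C"
    by (auto elim!: bounded_borelE)
  show ?thesis
  proof (rule bounded_borelI[where B="\<bar>B\<bar> * \<bar>C\<bar>"])
    show "\<bar>u x * v x\<bar> \<le> \<bar>B\<bar> * \<bar>C\<bar>" if "x \<in> space M" for x
      unfolding abs_mult using b[OF that] by (intro mult_mono) auto
  qed (use m in measurable)
qed

lemma bounded_borel_sum:
  "(\<And>i. i \<in> I \<Longrightarrow> bounded_borel M (u i)) \<Longrightarrow> bounded_borel M (\<lambda>x. \<Sum>i\<in>I. u i x)"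
  by (induction I rule: infinite_finite_induct) (auto intro: bounded_borel_add)

lemmas bounded_borel_intros = bounded_borel_const bounded_borel_add bounded_borel_mult bounded_borel_sum

text \<open>The Gibbs average as a quotient of two integrals over the fixed measure \<mu>, with the
  whole exponent as an argument. In this form only the integrands depend on the Gaussians, so
  derivatives follow from the quotient rule.\<close>

definition tilt_avg :: "'s measure \<Rightarrow> ('s \<Rightarrow> real) \<Rightarrow> ('s \<Rightarrow> real) \<Rightarrow> real"
  where "tilt_avg \<mu> H u = (\<integral>\<sigma>. u \<sigma> * exp (H \<sigma>) \<partial>\<mu>) / (\<integral>\<sigma>. exp (H \<sigma>) \<partial>\<mu>)"

definition tilt_cov :: "'s measure \<Rightarrow> ('s \<Rightarrow> real) \<Rightarrow> ('s \<Rightarrow> real) \<Rightarrow> ('s \<Rightarrow> real) \<Rightarrow> real"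
  where "tilt_cov \<mu> H u v = tilt_avg \<mu> H (\<lambda>\<sigma>. u \<sigma> * v \<sigma>) - tilt_avg \<mu> H u * tilt_avg \<mu> H v"

section \<open>Gibbs averages and covariances over a finite nonzero measure\<close>

locale nonzero_finite_measure = finite_measure M for M :: "'s measure" +
  assumes nonzero: "emeasure M (space M) \<noteq> 0"
begin

lemma integrable_mult_exp':
  "bounded_borel M u \<Longrightarrow> bounded_borel M H \<Longrightarrow> integrable M (\<lambda>x. u x * exp (H x))"
  by (elim bounded_borelE) (rule integrable_mult_exp)

lemma integrable_exp: "bounded_borel M H \<Longrightarrow> integrable M (\<lambda>x. exp (H x))"
  using integrable_mult_exp'[of "\<lambda>_. 1" H] by simp

lemma integral_exp_pos:
  assumes "bounded_borel M H"
  shows "0 < (\<integral>x. exp (H x) \<partial>M)"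
proof -
  from assms obtain K where K: "\<And>x. x \<in> space M \<Longrightarrow> \<bar>H x\<bar> \<le> K" by (auto simp: bounded_borel_def)
  have "0 < measure M (space M)"
    using nonzero by (simp add: emeasure_eq_measure zero_less_measure_iff)
  then have "0 < exp (- K) * measure M (space M)" by simp
  also have "\<dots> = (\<integral>x. exp (- K) \<partial>M)" by simp
  also have "\<dots> \<le> (\<integral>x. exp (H x) \<partial>M)"
  proof (rule integral_mono)
    show "exp (- K) \<le> exp (H x)" if "x \<in> space M" for x using K[OF that] by simp
  qed (auto intro: integrable_exp assms)
  finally show ?thesis .
qed

lemma abs_tilt_avg_le:
  assumes u: "u \<in> borel_measurable M" "\<And>x. x \<in> space M \<Longrightarrow> \<bar>u x\<bar> \<le> U" and H: "bounded_borel M H"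
  shows "\<bar>tilt_avg M H u\<bar> \<le> U"
proof -
  have bu: "bounded_borel M u" using u by (rule bounded_borelI)
  have "\<bar>\<integral>x. u x * exp (H x) \<partial>M\<bar> \<le> (\<integral>x. \<bar>u x * exp (H x)\<bar> \<partial>M)" by (rule integral_abs_bound)
  also have "\<dots> \<le> (\<integral>x. U * exp (H x) \<partial>M)"
    using u(2) integrable_abs[OF integrable_mult_exp'[OF bu H]] integrable_exp[OF H]
    by (intro integral_mono) (auto simp: abs_mult simp del: integrable_abs_iff)
  also have "\<dots> = U * (\<integral>x. exp (H x) \<partial>M)" by simp
  finally show ?thesis
    using integral_exp_pos[OF H] by (simp add: tilt_avg_def abs_divide abs_of_pos pos_divide_le_eq)
qed

lemma tilt_avg_sum:
  assumes "\<And>i. i \<in> I \<Longrightarrow> bounded_borel M (u i)" and H: "bounded_borel M H"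
  shows "tilt_avg M H (\<lambda>x. \<Sum>i\<in>I. a i * u i x) = (\<Sum>i\<in>I. a i * tilt_avg M H (u i))"
proof -
  have "(\<integral>x. (\<Sum>i\<in>I. a i * u i x) * exp (H x) \<partial>M) = (\<integral>x. (\<Sum>i\<in>I. a i * (u i x * exp (H x))) \<partial>M)"
    by (simp add: sum_distrib_right mult.assoc)
  also have "\<dots> = (\<Sum>i\<in>I. a i * (\<integral>x. u i x * exp (H x) \<partial>M))"
    using assms by (subst Bochner_Integration.integral_sum) (auto intro!: integrable_mult_exp')
  finally show ?thesis by (simp add: tilt_avg_def sum_divide_distrib)
qed

text \<open>Applied with both arguments equal to the magnetization, this expands its Gibbs variance
  into covariances with the single \<open>f e\<close>, which are the quantities produced by
  differentiation.\<close>

lemma tilt_cov_sum_right: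
  assumes "\<And>i. i \<in> I \<Longrightarrow> bounded_borel M (u i)" and H: "bounded_borel M H" and w: "bounded_borel M w"
  shows "tilt_cov M H w (\<lambda>x. \<Sum>i\<in>I. a i * u i x) = (\<Sum>i\<in>I. a i * tilt_cov M H w (u i))"
proof -
  have "(\<lambda>x. w x * (\<Sum>i\<in>I. a i * u i x)) = (\<lambda>x. \<Sum>i\<in>I. a i * (w x * u i x))"
    by (simp add: sum_distrib_left mult_ac)
  then show ?thesis
    using assms tilt_avg_sum[of I "\<lambda>i x. w x * u i x" H a] tilt_avg_sum[of I u H a]
    by (simp add: tilt_cov_def bounded_borel_mult algebra_simps sum_subtractf sum_distrib_left
        sum_distrib_right)
qed

text \<open>Differentiating the exponential inserts a factor \<open>v\<close> into the numerator and
  into the denominator. The quotient rule then leaves the average of \<open>u * v\<close> minus the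
  product of the averages.\<close>

lemma has_real_derivative_tilt_avg:
  assumes H: "bounded_borel M H" and u: "bounded_borel M u" and v: "bounded_borel M v"
  shows "((\<lambda>t. tilt_avg M (\<lambda>x. H x + t * v x) u) has_real_derivative
    tilt_cov M (\<lambda>x. H x + t * v x) u v) (at t)"
proof -
  have D: "((\<lambda>t. \<integral>x. w x * exp (H x + t * v x) \<partial>M) has_real_derivative
      (\<integral>x. (w x * v x) * exp (H x + t * v x) \<partial>M)) (at t)" if w: "bounded_borel M w" for w
  proof -
    obtain K where K: "\<And>x. x \<in> space M \<Longrightarrow> \<bar>H x\<bar> \<le> K" and [measurable]: "H \<in> borel_measurable M"
      using H by (auto simp: bounded_borel_def)
    \<comment> \<open>The factor \<open>exp (H x)\<close> does not depend on \<open>t\<close> and is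
      absorbed into the bounded function \<open>w\<close>, which leaves the pure exponential
      \<open>exp (t * v x)\<close> of the earlier derivative lemma.\<close>
    have eH: "bounded_borel M (\<lambda>x. exp (H x))"
    proof (rule bounded_borelI[where B="exp K"])
      show "\<bar>exp (H x)\<bar> \<le> exp K" if "x \<in> space M" for x using K[OF that] by simp
    qed measurable
    obtain U V where "(\<lambda>x. w x * exp (H x)) \<in> borel_measurable M" "v \<in> borel_measurable M"
      "\<And>x. x \<in> space M \<Longrightarrow> \<bar>w x * exp (H x)\<bar> \<le> U" "\<And>x. x \<in> space M \<Longrightarrow> \<bar>v x\<bar> \<le> V"
      using v bounded_borel_mult[OF w eH] by (auto elim!: bounded_borelE)
    from has_real_derivative_integral_exp[OF finite_measure_axioms this, of t]
    show ?thesis by (simp add: exp_add mult_ac)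
  qed
  have Z: "(\<integral>x. exp (H x + t * v x) \<partial>M) \<noteq> 0"
    by (intro less_imp_neq[symmetric] integral_exp_pos bounded_borel_intros H v)
  have quotient: "(n' * z - n * z') / (z * z) = n' / z - n / z * (z' / z)" if "z \<noteq> 0" for n n' z z' :: real
    using that by (simp add: field_simps)
  show ?thesis
    \<comment> \<open>The denominator is differentiated as the instance of \<open>D\<close> with the
      constant function 1.\<close>
    using DERIV_divide[OF D[OF u] D[OF bounded_borel_const[of M 1]]] Z
    by (simp only: quotient tilt_avg_def tilt_cov_def mult_1 not_False_eq_True simp_thms)
qed

lemma integral_gibbs_measure:
  assumes Y: "bounded_borel M Y" and u: "u \<in> borel_measurable M"
  shows "(\<integral>\<sigma>. u \<sigma> \<partial>gibbs_measure \<gamma> M Y) = tilt_avg M (\<lambda>\<sigma>. \<gamma> * Y \<sigma>) u"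
proof -
  have [measurable]: "Y \<in> borel_measurable M" using Y by (rule bounded_borel_measurable)
  have Z: "0 < partition_fun \<gamma> M Y"
    unfolding partition_fun_def by (intro integral_exp_pos bounded_borel_intros Y)
  have "(\<integral>\<sigma>. u \<sigma> \<partial>gibbs_measure \<gamma> M Y) = (\<integral>\<sigma>. exp (\<gamma> * Y \<sigma>) / partition_fun \<gamma> M Y * u \<sigma> \<partial>M)"
    unfolding gibbs_measure_def using u Z by (subst integral_real_density) auto
  also have "\<dots> = (\<integral>\<sigma>. u \<sigma> * exp (\<gamma> * Y \<sigma>) / partition_fun \<gamma> M Y \<partial>M)"
    by (simp add: mult_ac)
  finally show ?thesis by (simp add: tilt_avg_def partition_fun_def)
qed

text \<open>The passage from the measure \<open>gibbs_measure\<close> to the quotient form: the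
  square is expanded around the mean \<open>c\<close>, and everything is multiplied through by the
  positive partition function.\<close>

lemma gibbs_variance_eq_tilt_cov:
  assumes Y: "bounded_borel M Y" and u: "bounded_borel M u"
  shows "(\<integral>\<sigma>. (u \<sigma> - (\<integral>\<tau>. u \<tau> \<partial>gibbs_measure \<gamma> M Y))\<^sup>2 \<partial>gibbs_measure \<gamma> M Y)
    = tilt_cov M (\<lambda>\<sigma>. \<gamma> * Y \<sigma>) u u"
proof -
  have [measurable]: "u \<in> borel_measurable M" using u by (rule bounded_borel_measurable)
  let ?H = "\<lambda>\<sigma>. \<gamma> * Y \<sigma>"
  have H: "bounded_borel M ?H" by (intro bounded_borel_intros Y)
  have Z: "0 < (\<integral>\<sigma>. exp (?H \<sigma>) \<partial>M)" by (intro integral_exp_pos H)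
  define c where "c = tilt_avg M ?H u"
  have i: "integrable M (\<lambda>\<sigma>. u \<sigma> * u \<sigma> * exp (?H \<sigma>))" "integrable M (\<lambda>\<sigma>. u \<sigma> * exp (?H \<sigma>))"
    "integrable M (\<lambda>\<sigma>. exp (?H \<sigma>))"
    by (intro integrable_mult_exp' integrable_exp bounded_borel_intros u H)+
  \<comment> \<open>Cleared of the denominator, the definition of \<open>c\<close> merges the cross
    term with the constant term into a single \<open>- c\<^sup>2\<close> times the partition
    function.\<close>
  have c: "(\<integral>\<sigma>. u \<sigma> * exp (?H \<sigma>) \<partial>M) = c * (\<integral>\<sigma>. exp (?H \<sigma>) \<partial>M)"
    using Z by (simp add: c_def tilt_avg_def)
  have "(\<integral>\<sigma>. (u \<sigma> - c)\<^sup>2 * exp (?H \<sigma>) \<partial>M) =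
      (\<integral>\<sigma>. u \<sigma> * u \<sigma> * exp (?H \<sigma>) - 2 * c * (u \<sigma> * exp (?H \<sigma>)) + c\<^sup>2 * exp (?H \<sigma>) \<partial>M)"
    by (intro Bochner_Integration.integral_cong) (auto simp: power2_eq_square algebra_simps)
  also have "\<dots> = (\<integral>\<sigma>. u \<sigma> * u \<sigma> * exp (?H \<sigma>) \<partial>M) - c\<^sup>2 * (\<integral>\<sigma>. exp (?H \<sigma>) \<partial>M)"
    using i by (simp add: c power2_eq_square)
  finally have "tilt_avg M ?H (\<lambda>\<sigma>. (u \<sigma> - c)\<^sup>2) = tilt_avg M ?H (\<lambda>\<sigma>. u \<sigma> * u \<sigma>) - c\<^sup>2"
    using Z unfolding tilt_avg_def by (simp add: diff_divide_distrib)
  then have "tilt_avg M ?H (\<lambda>\<sigma>. (u \<sigma> - c)\<^sup>2) = tilt_cov M ?H u u"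
    by (simp add: tilt_cov_def c_def power2_eq_square)
  then show ?thesis by (simp add: integral_gibbs_measure[OF Y] c_def)
qed

end

section \<open>Gaussian integration by parts\<close>

abbreviation gauss :: "real measure" where "gauss \<equiv> density lborel std_normal_density"

text \<open>Stein's identity. The density satisfies \<open>p' t = - t * p t\<close>, so
  \<open>h' t * p t - t * h t * p t\<close> is the derivative of \<open>h t * p t\<close>, which
  vanishes at both ends because \<open>h\<close> is bounded.\<close>

lemma gauss_integral_by_parts:
  fixes h h' :: "real \<Rightarrow> real"
  assumes h: "\<And>t. (h has_real_derivative h' t) (at t)" and h': "\<And>t. isCont h' t"
    and B: "\<And>t. \<bar>h t\<bar> \<le> B" and B': "\<And>t. \<bar>h' t\<bar> \<le> B'"
  shows "(\<integral>t. t * h t \<partial>gauss) = (\<integral>t. h' t \<partial>gauss)"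
proof -
  let ?p = std_normal_density
  have hc: "isCont h t" for t using h by (rule DERIV_isCont)
  have [measurable]: "h \<in> borel_measurable borel" "h' \<in> borel_measurable borel"
    using hc h' by (auto intro!: borel_measurable_continuous_onI continuous_at_imp_continuous_on)
  have p: "(?p has_real_derivative - t * ?p t) (at t)" for t
    unfolding std_normal_density_def
    by (auto intro!: derivative_eq_intros simp: field_simps power2_eq_square)
  have pc: "isCont ?p t" for t using p by (rule DERIV_isCont)
  have i1: "integrable lborel (\<lambda>t. ?p t * h' t)"
    using B' integrable_normal_density[of 1 0]
    by (intro Bochner_Integration.integrable_bound[where f="\<lambda>t. B' * ?p t" and g="\<lambda>t. ?p t * h' t"])
      (auto simp: abs_mult mult.commute intro!: AE_I2 mult_right_mono order_trans[OF B'])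
  have i2: "integrable lborel (\<lambda>t. ?p t * (t * h t))"
    using B integrable_mult_right[OF integrable_std_normal_moment_abs[of 1], of B]
    by (intro Bochner_Integration.integrable_bound[where f="\<lambda>t. B * (?p t * \<bar>t\<bar> ^ 1)" and g="\<lambda>t. ?p t * (t * h t)"])
      (auto simp: abs_mult mult_ac intro!: AE_I2 mult_left_mono mult_right_mono order_trans[OF B])
  have lim: "((\<lambda>t. h t * ?p t) \<longlongrightarrow> 0) F" if "(?p \<longlongrightarrow> 0) F" for F
  proof (rule Lim_null_comparison)
    show "\<forall>\<^sub>F t in F. norm (h t * ?p t) \<le> B * ?p t"
      using B by (intro always_eventually) (auto simp: abs_mult intro!: mult_right_mono)
    show "((\<lambda>t. B * ?p t) \<longlongrightarrow> 0) F" using that by (auto intro!: tendsto_eq_intros)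
  qed
  have lims: "(?p \<longlongrightarrow> 0) at_top" "(?p \<longlongrightarrow> 0) at_bot"
    unfolding std_normal_density_def by real_asymp+
  \<comment> \<open>The fundamental theorem of calculus on the whole line; continuity of
    \<open>h'\<close> makes the integrand continuous, and the two boundary limits are both
    0.\<close>
  have "(LBINT t=-\<infinity>..\<infinity>. ?p t * h' t - ?p t * (t * h t)) = 0 - 0"
  proof (rule interval_integral_FTC_integrable[where F="\<lambda>t. h t * ?p t"])
    show "((\<lambda>t. h t * ?p t) has_vector_derivative ?p t * h' t - ?p t * (t * h t)) (at t)" for t
      unfolding has_real_derivative_iff_has_vector_derivative[symmetric]
      by (rule derivative_eq_intros h p refl)+ (simp add: algebra_simps)
    show "isCont (\<lambda>t. ?p t * h' t - ?p t * (t * h t)) t" for t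
      by (intro continuous_intros hc h' pc)
    show "set_integrable lborel (einterval (- \<infinity>) \<infinity>) (\<lambda>t. ?p t * h' t - ?p t * (t * h t))"
      using i1 i2 by (simp add: set_integrable_def einterval_def)
    show "(((\<lambda>t. h t * ?p t) \<circ> real_of_ereal) \<longlongrightarrow> 0) (at_right (- \<infinity>))"
      using lim[OF lims(2)] by (simp add: ereal_tendsto_simps1)
    show "(((\<lambda>t. h t * ?p t) \<circ> real_of_ereal) \<longlongrightarrow> 0) (at_left \<infinity>)"
      using lim[OF lims(1)] by (simp add: ereal_tendsto_simps1)
  qed simp
  then have "(\<integral>t. ?p t * h' t - ?p t * (t * h t) \<partial>lborel) = 0"
    by (simp add: interval_lebesgue_integral_def set_lebesgue_integral_def einterval_def)
  then show ?thesis
    using i1 i2 by (simp add: integral_real_density)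
qed

interpretation gauss: prob_space gauss
  by (rule prob_space_normal_density) simp

lemma gauss_moments:
  "integrable gauss (\<lambda>t. t)" "integrable gauss (\<lambda>t. t * t)"
  "(\<integral>t. t \<partial>gauss) = 0" "(\<integral>t. t * t \<partial>gauss) = 1"
  using integrable_std_normal_moment[of 1] integrable_std_normal_moment[of 2]
    integral_std_normal_moment_odd[of 0] integral_std_normal_moment_even[of 1]
  by (simp_all add: integrable_real_density integral_real_density power2_eq_square fact_numeral)

section \<open>Moments and integration by parts for a vector of independent Gaussians\<close>

interpretation gauss_prod: product_prob_space "\<lambda>_ :: 'e. gauss" UNIV ..

abbreviation gauss_PiM :: "'e set \<Rightarrow> ('e \<Rightarrow> real) measure"
  where "gauss_PiM E \<equiv> Pi\<^sub>M E (\<lambda>_. gauss)"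

lemma prob_space_gauss_PiM: "prob_space (gauss_PiM E)"
  by (intro prob_space_PiM gauss.prob_space_axioms)

text \<open>The product of two coordinates is written as a product over all of \<open>E\<close>,
  with factor 1 at every other index, so that the integral factorizes. When the two indices
  coincide, both factors meet at the same coordinate and give its square.\<close>

lemma
  assumes E: "finite E" and e: "e \<in> E" "e' \<in> E"
  shows integrable_gauss_PiM_mult: "integrable (gauss_PiM E) (\<lambda>x. x e * x e')"
    and integral_gauss_PiM_mult: "(\<integral>x. x e * x e' \<partial>gauss_PiM E) = (if e = e' then 1 else 0)"
proof -
  let ?f = "\<lambda>i t. (if i = e then t else 1) * (if i = e' then t else (1::real))"
  have f: "(\<Prod>i\<in>E. ?f i (x i)) = x e * x e'" for x :: "_ \<Rightarrow> real"
    using E e by (simp add: prod.distrib prod.delta)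
  have i: "integrable gauss (?f i)" for i
    using gauss_moments by (cases "i = e"; cases "i = e'") simp_all
  have v: "integral\<^sup>L gauss (?f i) = (if e = e' \<or> i \<noteq> e \<and> i \<noteq> e' then 1 else 0)" for i
    using gauss_moments gauss.prob_space by (cases "i = e"; cases "i = e'") simp_all
  show "integrable (gauss_PiM E) (\<lambda>x. x e * x e')"
    using gauss_prod.product_integrable_prod[OF E, of ?f, OF i] by (simp only: f)
  have "(\<integral>x. x e * x e' \<partial>gauss_PiM E) = (\<Prod>i\<in>E. integral\<^sup>L gauss (?f i))"
    using gauss_prod.product_integral_prod[OF E, of ?f, OF i] by (simp only: f)
  also have "\<dots> = (if e = e' then 1 else 0)"
    \<comment> \<open>For distinct indices the factor at \<open>e\<close> is the mean of a standard
      Gaussian, which annihilates the product.\<close>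
    unfolding v using E e by (auto intro!: prod_zero)
  finally show "(\<integral>x. x e * x e' \<partial>gauss_PiM E) = (if e = e' then 1 else 0)" .
qed

lemma
  assumes E: "finite E"
  shows integrable_gauss_PiM_linear_square: "integrable (gauss_PiM E) (\<lambda>x. (\<Sum>e\<in>E. a e * x e)\<^sup>2)"
    and integral_gauss_PiM_linear_square: "(\<integral>x. (\<Sum>e\<in>E. a e * x e)\<^sup>2 \<partial>gauss_PiM E) = (L2_set a E)\<^sup>2"
proof -
  have sq: "(\<Sum>e\<in>E. a e * x e)\<^sup>2 = (\<Sum>e\<in>E. \<Sum>e'\<in>E. a e * a e' * (x e * x e'))" for x
    by (simp add: power2_eq_square sum_product mult_ac)
  show "integrable (gauss_PiM E) (\<lambda>x. (\<Sum>e\<in>E. a e * x e)\<^sup>2)"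
    unfolding sq using E by (intro Bochner_Integration.integrable_sum integrable_mult_right integrable_gauss_PiM_mult)
  have "(\<integral>x. (\<Sum>e\<in>E. a e * x e)\<^sup>2 \<partial>gauss_PiM E) = (\<Sum>e\<in>E. \<Sum>e'\<in>E. a e * a e' * (if e = e' then 1 else 0))"
    unfolding sq using E
    by (simp add: Bochner_Integration.integral_sum integrable_gauss_PiM_mult integral_gauss_PiM_mult
        Bochner_Integration.integrable_sum)
  also have "\<dots> = (\<Sum>e\<in>E. \<Sum>e'\<in>E. if e = e' then a e * a e' else 0)"
    by (intro sum.cong) auto
  also have "\<dots> = (L2_set a E)\<^sup>2"
    using E by (simp add: L2_set_def sum_nonneg power2_eq_square)
  finally show "(\<integral>x. (\<Sum>e\<in>E. a e * x e)\<^sup>2 \<partial>gauss_PiM E) = (L2_set a E)\<^sup>2" .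
qed

lemma integrable_gauss_PiM_component:
  assumes "e \<in> E"
  shows "integrable (gauss_PiM E) (\<lambda>x. x e)"
proof (rule integrable_distr)
  show "(\<lambda>x. x e) \<in> measurable (gauss_PiM E) gauss" using assms by measurable
  show "integrable (distr (gauss_PiM E) gauss (\<lambda>x. x e)) (\<lambda>t. t)"
    using assms gauss_moments(1) by (subst distr_PiM_component) (auto intro: gauss.prob_space_axioms)
qed

lemma integrable_gauss_PiM_component_mult:
  assumes "e \<in> E" and [measurable]: "\<Phi> \<in> borel_measurable (gauss_PiM E)" and B: "\<And>x. \<bar>\<Phi> x\<bar> \<le> B"
  shows "integrable (gauss_PiM E) (\<lambda>x. x e * \<Phi> x)"
proof (rule Bochner_Integration.integrable_bound)
  show "integrable (gauss_PiM E) (\<lambda>x. B * x e)"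
    by (intro integrable_mult_right integrable_gauss_PiM_component assms)
  show "(\<lambda>x. x e * \<Phi> x) \<in> borel_measurable (gauss_PiM E)"
    using borel_measurable_integrable[OF integrable_gauss_PiM_component[OF \<open>e \<in> E\<close>]] by measurable
  have "norm (x e * \<Phi> x) \<le> norm (B * x e)" for x
    unfolding norm_mult using mult_left_mono[of "\<bar>\<Phi> x\<bar>" "\<bar>B\<bar>" "\<bar>x e\<bar>"] B[of x]
    by (simp add: mult.commute)
  then show "AE x in gauss_PiM E. norm (x e * \<Phi> x) \<le> norm (B * x e)" by simp
qed

text \<open>Fubini isolates coordinate \<open>e\<close>, and the one-dimensional identity applies to
  the inner integral with the other coordinates frozen. The update \<open>x(e := t)\<close>
  expresses that \<open>\<Phi>'\<close> is the partial derivative in that coordinate.\<close>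

lemma gauss_PiM_integral_by_parts:
  fixes \<Phi> \<Phi>' :: "('e \<Rightarrow> real) \<Rightarrow> real"
  assumes E: "finite E" "e \<in> E"
    and [measurable]: "\<Phi> \<in> borel_measurable (gauss_PiM E)" "\<Phi>' \<in> borel_measurable (gauss_PiM E)"
    and D: "\<And>x t. ((\<lambda>t. \<Phi> (x(e := t))) has_real_derivative \<Phi>' (x(e := t))) (at t)"
    and C: "\<And>x t. isCont (\<lambda>t. \<Phi>' (x(e := t))) t"
    and B: "\<And>x. \<bar>\<Phi> x\<bar> \<le> B" and B': "\<And>x. \<bar>\<Phi>' x\<bar> \<le> B'"
  shows "(\<integral>x. x e * \<Phi> x \<partial>gauss_PiM E) = (\<integral>x. \<Phi>' x \<partial>gauss_PiM E)"
proof -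
  interpret prob_space "gauss_PiM E" by (rule prob_space_gauss_PiM)
  let ?J = "E - {e}"
  have J: "finite ?J" "e \<notin> ?J" and ins: "insert e ?J = E" using E by auto
  have i1: "integrable (gauss_PiM E) (\<lambda>x. x e * \<Phi> x)"
    using E B by (intro integrable_gauss_PiM_component_mult) auto
  have i2: "integrable (gauss_PiM E) \<Phi>'"
    using B' by (intro integrable_const_bound[where B=B']) auto
  have "(\<integral>x. x e * \<Phi> x \<partial>gauss_PiM E) = (\<integral>x. (\<integral>t. t * \<Phi> (x(e := t)) \<partial>gauss) \<partial>gauss_PiM ?J)"
    using gauss_prod.product_integral_insert[OF J, unfolded ins, OF i1] by simp
  also have "\<dots> = (\<integral>x. (\<integral>t. \<Phi>' (x(e := t)) \<partial>gauss) \<partial>gauss_PiM ?J)"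
    using gauss_integral_by_parts[OF D C B B'] by simp
  also have "\<dots> = (\<integral>x. \<Phi>' x \<partial>gauss_PiM E)"
    using gauss_prod.product_integral_insert[OF J, unfolded ins, OF i2] by simp
  finally show ?thesis .
qed

text \<open>Replaces Cauchy-Schwarz: choosing \<open>s\<close> as the standard deviation of \<open>x\<close> gives \<open>A * s\<close> on average.\<close>

lemma mult_le_young:
  fixes x c s :: real
  assumes "\<bar>c\<bar> \<le> A" "0 < s"
  shows "x * c \<le> A * (x\<^sup>2 / (2 * s) + s / 2)"
proof -
  have "0 \<le> (\<bar>x\<bar> - s)\<^sup>2" by simp
  then have "\<bar>x\<bar> \<le> x\<^sup>2 / (2 * s) + s / 2"
    using assms(2) by (simp add: field_simps power2_eq_square abs_mult_self_eq)
  have "x * c \<le> \<bar>x\<bar> * \<bar>c\<bar>" by (metis abs_ge_self abs_mult)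
  also have "\<dots> \<le> (x\<^sup>2 / (2 * s) + s / 2) * A"
    using assms \<open>\<bar>x\<bar> \<le> _\<close> by (intro mult_mono) auto
  finally show ?thesis by (simp add: mult.commute)
qed

text \<open>The pointwise inequality \<open>mult_le_young\<close> is integrated with
  \<open>s = L2_set a E\<close>. As the linear form has second moment \<open>s\<^sup>2\<close>, its
  two terms each contribute \<open>s / 2\<close>.\<close>

lemma gauss_PiM_linear_mult_le:
  assumes E: "finite E" and [measurable]: "\<Phi> \<in> borel_measurable (gauss_PiM E)" and A: "\<And>x. \<bar>\<Phi> x\<bar> \<le> A"
  shows "(\<integral>x. (\<Sum>e\<in>E. a e * x e) * \<Phi> x \<partial>gauss_PiM E) \<le> A * L2_set a E"
proof (cases "L2_set a E = 0")
  \<comment> \<open>The choice of \<open>s\<close> divides by the norm, so norm 0 is separate; there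
    all coefficients vanish.\<close>
  case True
  then have "\<And>e. e \<in> E \<Longrightarrow> a e = 0" using E by (simp add: L2_set_eq_0_iff)
  then show ?thesis by (simp add: True)
next
  case False
  then have s: "0 < L2_set a E" (is "0 < ?s") by (simp add: order_less_le)
  interpret prob_space "gauss_PiM E" by (rule prob_space_gauss_PiM)
  have i: "integrable (gauss_PiM E) (\<lambda>x. (\<Sum>e\<in>E. a e * x e) * \<Phi> x)"
    unfolding sum_distrib_right mult.assoc using A
    by (intro Bochner_Integration.integrable_sum integrable_mult_right integrable_gauss_PiM_component_mult) auto
  note sq = integrable_gauss_PiM_linear_square[OF E, of a]
  have "(\<integral>x. (\<Sum>e\<in>E. a e * x e) * \<Phi> x \<partial>gauss_PiM E)
      \<le> (\<integral>x. A * ((\<Sum>e\<in>E. a e * x e)\<^sup>2 / (2 * ?s) + ?s / 2) \<partial>gauss_PiM E)"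
    using sq by (intro integral_mono[OF i] mult_le_young s A) auto
  also have "\<dots> = A * (?s\<^sup>2 / (2 * ?s) + ?s / 2)"
    using sq by (simp add: integral_gauss_PiM_linear_square[OF E] prob_space)
  also have "\<dots> = A * ?s" using s by (simp add: field_simps power2_eq_square)
  finally show ?thesis .
qed

section \<open>The variance bound for fixed disorder\<close>

context nonzero_finite_measure
begin

lemma gauss_PiM_tilt_cov_le:
  fixes E :: "'e set" and f :: "'e \<Rightarrow> 's \<Rightarrow> real" and a :: "'e \<Rightarrow> real" and \<gamma> :: real
  assumes E: "finite E" and f [measurable]: "\<And>e. e \<in> E \<Longrightarrow> f e \<in> borel_measurable M"
    and f1: "\<And>e x. e \<in> E \<Longrightarrow> x \<in> space M \<Longrightarrow> \<bar>f e x\<bar> \<le> 1" and \<gamma>: "0 < \<gamma>"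
  defines "m \<equiv> bond_magnetization E a f"
  defines "H \<equiv> \<lambda>x \<sigma>. \<gamma> * gaussian_field E x f \<sigma>"
  shows "(\<integral>x. tilt_cov M (H x) m m \<partial>gauss_PiM E) \<le> (1 / \<gamma>) * L2_set a E * (\<Sum>e\<in>E. \<bar>a e\<bar>)"
proof -
  interpret P: prob_space "gauss_PiM E" by (rule prob_space_gauss_PiM)
  define A where "A = (\<Sum>e\<in>E. \<bar>a e\<bar>)"
  have bf: "bounded_borel M (f e)" if "e \<in> E" for e
    using f f1 that by (intro bounded_borelI)
  have bm: "bounded_borel M m"
    unfolding m_def bond_magnetization_def by (intro bounded_borel_intros bf)
  have bH: "bounded_borel M (H x)" for x
    unfolding H_def gaussian_field_def by (intro bounded_borel_intros bf)
  note [measurable] = bounded_borel_measurable[OF bm]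
  have mA: "\<bar>m \<sigma>\<bar> \<le> A" if "\<sigma> \<in> space M" for \<sigma>
  proof -
    have "\<bar>m \<sigma>\<bar> \<le> (\<Sum>e\<in>E. \<bar>a e * f e \<sigma>\<bar>)" unfolding m_def bond_magnetization_def by (rule sum_abs)
    also have "\<dots> \<le> A"
      unfolding A_def abs_mult using f1 that by (intro sum_mono mult_left_le) auto
    finally show ?thesis .
  qed
  have A0: "0 \<le> A" by (simp add: A_def sum_nonneg)
  define \<Phi> where "\<Phi> x = tilt_avg M (H x) m" for x
  \<comment> \<open>\<open>\<Psi> e\<close> is the partial derivative of \<open>\<Phi>\<close> in
    the coordinate \<open>e\<close>; the factor \<gamma> comes from the exponent.\<close>
  define \<Psi> where "\<Psi> e x = \<gamma> * tilt_cov M (H x) m (f e)" for e x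
  have \<Phi>A: "\<bar>\<Phi> x\<bar> \<le> A" for x
    unfolding \<Phi>_def using mA by (intro abs_tilt_avg_le bH) auto
  \<comment> \<open>A crude bound, \<open>A\<close> for the average of the product plus
    \<open>A\<close> for the product of the averages. It serves integrability and integration by
    parts and does not enter the final constant.\<close>
  have \<Psi>A: "\<bar>\<Psi> e x\<bar> \<le> \<gamma> * (2 * A)" if e: "e \<in> E" for e x
  proof -
    have mf: "\<bar>m \<sigma> * f e \<sigma>\<bar> \<le> A" if "\<sigma> \<in> space M" for \<sigma>
      unfolding abs_mult using mult_mono[OF mA[OF that] f1[OF e that]] A0 by simp
    have "\<bar>tilt_avg M (H x) (\<lambda>\<sigma>. m \<sigma> * f e \<sigma>)\<bar> \<le> A"
      using mf e by (intro abs_tilt_avg_le bH) auto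
    moreover have "\<bar>tilt_avg M (H x) m * tilt_avg M (H x) (f e)\<bar> \<le> A * 1"
      unfolding abs_mult
      using A0 mA \<Phi>A[of x] f1 e by (intro mult_mono abs_tilt_avg_le bH) (auto simp: \<Phi>_def)
    ultimately have "\<bar>tilt_cov M (H x) m (f e)\<bar> \<le> 2 * A"
      unfolding tilt_cov_def by linarith
    then show ?thesis using \<gamma> by (simp add: \<Psi>_def abs_mult)
  qed
  \<comment> \<open>Joint measurability in the Gaussian vector and the configuration makes integrals
    over the configuration measurable in \<open>x\<close>.\<close>
  have Hm: "(\<lambda>p. H (fst p) (snd p)) \<in> borel_measurable (gauss_PiM E \<Otimes>\<^sub>M M)"
    unfolding H_def gaussian_field_def
  proof (intro borel_measurable_times borel_measurable_sum borel_measurable_const)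
    fix e assume e: "e \<in> E"
    have "(\<lambda>x. x e) \<in> borel_measurable (gauss_PiM E)"
      using integrable_gauss_PiM_component[OF e] by (rule borel_measurable_integrable)
    then show "(\<lambda>p. fst p e) \<in> borel_measurable (gauss_PiM E \<Otimes>\<^sub>M M)" by measurable
    show "(\<lambda>p. f e (snd p)) \<in> borel_measurable (gauss_PiM E \<Otimes>\<^sub>M M)" using f[OF e] by measurable
  qed
  have avg_m: "(\<lambda>x. tilt_avg M (H x) u) \<in> borel_measurable (gauss_PiM E)"
    if [measurable]: "u \<in> borel_measurable M" for u
    unfolding tilt_avg_def
    by (intro borel_measurable_divide borel_measurable_lebesgue_integral)
      (use Hm in \<open>simp_all add: case_prod_beta'\<close>)
  have \<Phi>m: "\<Phi> \<in> borel_measurable (gauss_PiM E)"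
    unfolding \<Phi>_def[abs_def] by (intro avg_m) measurable
  have \<Psi>m: "\<Psi> e \<in> borel_measurable (gauss_PiM E)" if "e \<in> E" for e
    unfolding \<Psi>_def[abs_def] tilt_cov_def using that
    by (intro borel_measurable_times borel_measurable_diff avg_m borel_measurable_const) auto
  have stein: "(\<integral>x. x e * \<Phi> x \<partial>gauss_PiM E) = (\<integral>x. \<Psi> e x \<partial>gauss_PiM E)" if e: "e \<in> E" for e
  proof (rule gauss_PiM_integral_by_parts[OF E e \<Phi>m \<Psi>m[OF e] _ _ \<Phi>A \<Psi>A[OF e]])
    fix x :: "'e \<Rightarrow> real" and t :: real
    \<comment> \<open>\<open>H0\<close> collects the terms of the other indices, so the exponent is
      affine in the updated coordinate, with slope \<open>\<gamma> * f e \<sigma>\<close>. This is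
      the shape that \<open>has_real_derivative_tilt_avg\<close> handles.\<close>
    define H0 where "H0 \<sigma> = \<gamma> * gaussian_field (E - {e}) x f \<sigma>" for \<sigma>
    have bH0: "bounded_borel M H0"
      unfolding H0_def[abs_def] gaussian_field_def by (intro bounded_borel_intros bf) auto
    have Hx: "H (x(e := s)) = (\<lambda>\<sigma>. H0 \<sigma> + s * (\<gamma> * f e \<sigma>))" for s
      unfolding H_def H0_def gaussian_field_def
      using E e by (auto simp: sum.remove algebra_simps intro!: ext sum.cong)
    have D: "((\<lambda>t. tilt_avg M (H (x(e := t))) u) has_real_derivative
        tilt_cov M (H (x(e := t))) u (\<lambda>\<sigma>. \<gamma> * f e \<sigma>)) (at t)" if "bounded_borel M u" for u
      unfolding Hx by (intro has_real_derivative_tilt_avg bounded_borel_intros bH0 bf e that)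
    then have cont: "isCont (\<lambda>t. tilt_avg M (H (x(e := t))) u) t" if "bounded_borel M u" for u
      using that by (blast intro: DERIV_isCont)
    have "tilt_cov M K u (\<lambda>\<sigma>. \<gamma> * f e \<sigma>) = \<gamma> * tilt_cov M K u (f e)" for K u
      by (simp add: tilt_cov_def tilt_avg_def mult.left_commute[of _ \<gamma>] mult.assoc right_diff_distrib)
    then show "((\<lambda>t. \<Phi> (x(e := t))) has_real_derivative \<Psi> e (x(e := t))) (at t)"
      using D[OF bm] by (simp add: \<Phi>_def \<Psi>_def)
    \<comment> \<open>\<open>\<Psi> e\<close> is built from tilted averages of bounded functions,
      each differentiable and hence continuous in \<open>t\<close>.\<close>
    show "isCont (\<lambda>t. \<Psi> e (x(e := t))) t"
      unfolding \<Psi>_def tilt_cov_def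
      by (intro continuous_intros cont bounded_borel_intros bm bf e)
  qed
  have i: "integrable (gauss_PiM E) (\<Psi> e)" if "e \<in> E" for e
    using \<Psi>m \<Psi>A that by (intro P.integrable_const_bound[where B="\<gamma> * (2 * A)"]) auto
  have cov: "\<gamma> * tilt_cov M (H x) m m = (\<Sum>e\<in>E. a e * \<Psi> e x)" for x
  proof -
    have "tilt_cov M (H x) m m = (\<Sum>e\<in>E. a e * tilt_cov M (H x) m (f e))"
      using tilt_cov_sum_right[OF bf bH bm, of E] by (simp add: m_def bond_magnetization_def[abs_def])
    then show ?thesis by (simp add: \<Psi>_def sum_distrib_left mult_ac)
  qed
  have "\<gamma> * (\<integral>x. tilt_cov M (H x) m m \<partial>gauss_PiM E) = (\<integral>x. (\<Sum>e\<in>E. a e * \<Psi> e x) \<partial>gauss_PiM E)"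
    by (simp flip: cov)
  also have "\<dots> = (\<Sum>e\<in>E. a e * (\<integral>x. x e * \<Phi> x \<partial>gauss_PiM E))"
    using i by (simp add: Bochner_Integration.integral_sum stein)
  \<comment> \<open>The sum is recombined into one linear form before estimating. Bounding the
    summands separately would produce the l1 norm of \<open>a\<close> where the l2 norm is
    wanted.\<close>
  also have "\<dots> = (\<integral>x. (\<Sum>e\<in>E. a e * x e) * \<Phi> x \<partial>gauss_PiM E)"
    using integrable_gauss_PiM_component_mult[OF _ \<Phi>m \<Phi>A]
    by (simp add: sum_distrib_right mult.assoc Bochner_Integration.integral_sum)
  also have "\<dots> \<le> A * L2_set a E" by (rule gauss_PiM_linear_mult_le[OF E \<Phi>m \<Phi>A])
  finally show ?thesis using \<gamma> by (simp add: A_def field_simps)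
qed

end

section \<open>Averaging over the disorder\<close>

text \<open>Since \<mu> is random, the integrating measure varies together with the integrand. This
  lemma supplies the measurability of Gibbs averages in the disorder that Fubini requires.\<close>

lemma borel_measurable_integral_finite_kernel:
  fixes k :: "'w \<Rightarrow> 's \<Rightarrow> real"
  assumes k: "case_prod k \<in> borel_measurable (D \<Otimes>\<^sub>M S)"
    and \<mu>_sets: "\<And>\<omega>. \<omega> \<in> space D \<Longrightarrow> sets (\<mu> \<omega>) = sets S"
    and \<mu>_nonzero: "\<And>\<omega>. \<omega> \<in> space D \<Longrightarrow> nonzero_finite_measure (\<mu> \<omega>)"
    and \<mu>_measurable: "\<And>A. A \<in> sets S \<Longrightarrow> (\<lambda>\<omega>. emeasure (\<mu> \<omega>) A) \<in> borel_measurable D"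
  shows "(\<lambda>\<omega>. \<integral>\<sigma>. k \<omega> \<sigma> \<partial>\<mu> \<omega>) \<in> borel_measurable D"
proof -
  \<comment> \<open>Normalising makes \<open>\<mu>\<close> a probability kernel, to which the Giry monad library applies.\<close>
  define r where "r \<omega> = enn2real (emeasure (\<mu> \<omega>) (space S))" for \<omega>
  define N where "N \<omega> = density (\<mu> \<omega>) (\<lambda>_. ennreal (1 / r \<omega>))" for \<omega>
  have [measurable]: "r \<in> borel_measurable D"
    unfolding r_def[abs_def] by (intro borel_measurable_enn2real \<mu>_measurable sets.top)
  have sp: "space (\<mu> \<omega>) = space S" if "\<omega> \<in> space D" for \<omega>
    using \<mu>_sets[OF that] by (rule sets_eq_imp_space_eq)
  have r: "0 < r \<omega>" "ennreal (r \<omega>) = emeasure (\<mu> \<omega>) (space S)" if "\<omega> \<in> space D" for \<omega>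
  proof -
    interpret nonzero_finite_measure "\<mu> \<omega>" by (rule \<mu>_nonzero[OF that])
    show "0 < r \<omega>" "ennreal (r \<omega>) = emeasure (\<mu> \<omega>) (space S)"
      using nonzero by (auto simp: r_def emeasure_eq_measure measure_nonneg order_less_le sp[OF that] simp flip: sp[OF that])
  qed
  have emN: "emeasure (N \<omega>) A = ennreal (1 / r \<omega>) * emeasure (\<mu> \<omega>) A" if "\<omega> \<in> space D" "A \<in> sets S" for \<omega> A
    unfolding N_def using that \<mu>_sets by (intro emeasure_density_const) auto
  have setsN: "sets (N \<omega>) = sets S" if "\<omega> \<in> space D" for \<omega>
    using \<mu>_sets[OF that] by (simp add: N_def)
  have [measurable]: "N \<in> measurable D (subprob_algebra S)"
  proof (rule measurable_subprob_algebra[OF _ setsN])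
    fix \<omega> assume \<omega>: "\<omega> \<in> space D"
    have "emeasure (N \<omega>) (space S) = 1"
      using r[OF \<omega>] by (simp add: emN[OF \<omega>] ennreal_mult[symmetric] flip: r(2)[OF \<omega>])
    then have "prob_space (N \<omega>)"
      by (intro prob_spaceI) (simp add: sets_eq_imp_space_eq[OF setsN[OF \<omega>]])
    then show "subprob_space (N \<omega>)" by (rule prob_space_imp_subprob_space)
  next
    fix A assume A [measurable]: "A \<in> sets S"
    have "(\<lambda>\<omega>. ennreal (1 / r \<omega>) * emeasure (\<mu> \<omega>) A) \<in> borel_measurable D"
      using \<mu>_measurable[OF A] by measurable
    then show "(\<lambda>\<omega>. emeasure (N \<omega>) A) \<in> borel_measurable D"
      by (rule measurable_cong[THEN iffD2, rotated]) (simp add: emN A)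
  qed
  note [measurable] = k measurable_distr2
  \<comment> \<open>Pushing \<open>N \<omega>\<close> forward under
    \<open>\<sigma> \<mapsto> (\<omega>, \<sigma>)\<close> moves the dependence on \<omega> from the
    integrand into the kernel: the integrand becomes the fixed function \<open>case_prod k\<close>.
    The factor \<open>r \<omega>\<close> restores the total mass.\<close>
  have "(\<lambda>\<omega>. r \<omega> * (\<integral>p. case_prod k p \<partial>distr (N \<omega>) (D \<Otimes>\<^sub>M S) (\<lambda>\<sigma>. (\<omega>, \<sigma>)))) \<in> borel_measurable D"
    by measurable
  then show ?thesis
  proof (rule measurable_cong[THEN iffD2, rotated])
    fix \<omega> assume \<omega>: "\<omega> \<in> space D"
    have P: "(\<lambda>\<sigma>. (\<omega>, \<sigma>)) \<in> measurable S (D \<Otimes>\<^sub>M S)" using \<omega> by simp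
    have k\<omega>: "k \<omega> \<in> borel_measurable S" using measurable_compose[OF P k] by (simp only: prod.case)
    have PN: "(\<lambda>\<sigma>. (\<omega>, \<sigma>)) \<in> measurable (N \<omega>) (D \<Otimes>\<^sub>M S)"
      using P by (simp only: measurable_cong_sets[OF setsN[OF \<omega>] refl])
    have k\<mu>: "k \<omega> \<in> borel_measurable (\<mu> \<omega>)"
      using k\<omega> by (simp only: measurable_cong_sets[OF \<mu>_sets[OF \<omega>] refl])
    have "(\<integral>p. case_prod k p \<partial>distr (N \<omega>) (D \<Otimes>\<^sub>M S) (\<lambda>\<sigma>. (\<omega>, \<sigma>))) = (\<integral>\<sigma>. k \<omega> \<sigma> \<partial>N \<omega>)"
      using integral_distr[OF PN k] by (simp only: prod.case)
    also have "\<dots> = (\<integral>\<sigma>. 1 / r \<omega> * k \<omega> \<sigma> \<partial>\<mu> \<omega>)"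
      unfolding N_def using r(1)[OF \<omega>] by (intro integral_real_density k\<mu>) auto
    finally show "(\<integral>\<sigma>. k \<omega> \<sigma> \<partial>\<mu> \<omega>) = r \<omega> * (\<integral>p. case_prod k p \<partial>distr (N \<omega>) (D \<Otimes>\<^sub>M S) (\<lambda>\<sigma>. (\<omega>, \<sigma>)))"
      using r(1)[OF \<omega>] by simp
  qed
qed

section \<open>The joint law of the Gaussians and the remaining disorder\<close>

lemma (in prob_space) distr_indep_gaussians:
  assumes E: "E \<noteq> {}" and g_indep: "indep_vars (\<lambda>_. borel) g E"
    and g_normal: "\<And>e. e \<in> E \<Longrightarrow> distributed M lborel (g e) std_normal_density"
  shows "distr M (\<Pi>\<^sub>M e\<in>E. borel) (\<lambda>\<omega>. \<lambda>e\<in>E. g e \<omega>) = gauss_PiM E"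
proof -
  have rv: "random_variable borel (g e)" if "e \<in> E" for e
    using distributed_measurable[OF g_normal[OF that]] by simp
  have "distr M borel (g e) = gauss" if "e \<in> E" for e
    using distributed_distr_eq_density[OF g_normal[OF that]] by (simp cong: distr_cong)
  then show ?thesis
    using g_indep indep_vars_iff_distr_eq_PiM'[OF E rv] by (simp cong: PiM_cong)
qed

text \<open>The identity map into \<open>D\<close> acts as the random element carrying the disorder,
  and its law is \<open>M\<close> restricted to \<open>D\<close>. Independence of \<open>D\<close>
  and \<open>X\<close> is then the product formula on rectangles, which determines the joint
  law.\<close>

lemma (in prob_space) distr_pair_indep_subalgebra:
  assumes D: "subalgebra M D" and X [measurable]: "X \<in> measurable M B"
    and indep: "indep_set (sets D) (sets (vimage_algebra (space M) X B))"
  shows "distr M D (\<lambda>\<omega>. \<omega>) \<Otimes>\<^sub>M distr M B X = distr M (D \<Otimes>\<^sub>M B) (\<lambda>\<omega>. (\<omega>, X \<omega>))"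
proof (rule pair_measure_eqI)
  have D': "space D = space M" "sets D \<subseteq> sets M" using D by (auto simp: subalgebra_def)
  have id_vimage: "(\<lambda>\<omega>. \<omega>) -` A \<inter> space M = A" if "A \<in> sets D" for A
    using sets.sets_into_space[OF that] D'(1) by auto
  then have id [measurable]: "(\<lambda>\<omega>. \<omega>) \<in> measurable M D"
    using D' by (intro measurableI) auto
  show "sigma_finite_measure (distr M D (\<lambda>\<omega>. \<omega>))" "sigma_finite_measure (distr M B X)"
    using prob_space_distr[OF id] prob_space_distr[OF X] by (simp_all add: prob_space_imp_sigma_finite)
  fix A A' assume "A \<in> sets (distr M D (\<lambda>\<omega>. \<omega>))" "A' \<in> sets (distr M B X)"
  then have A: "A \<in> sets D" "A' \<in> sets B" by simp_all
  have "X -` A' \<inter> space M \<in> sets (vimage_algebra (space M) X B)"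
    using A(2) by (rule in_vimage_algebra)
  then have "prob (A \<inter> (X -` A' \<inter> space M)) = prob A * prob (X -` A' \<inter> space M)"
    using indep A(1) by (intro indep_setD)
  moreover have "(\<lambda>\<omega>. (\<omega>, X \<omega>)) -` (A \<times> A') \<inter> space M = A \<inter> (X -` A' \<inter> space M)"
    using id_vimage[OF A(1)] by auto
  ultimately show "emeasure (distr M D (\<lambda>\<omega>. \<omega>)) A * emeasure (distr M B X) A' =
      emeasure (distr M (D \<Otimes>\<^sub>M B) (\<lambda>\<omega>. (\<omega>, X \<omega>))) (A \<times> A')"
    using A by (simp add: emeasure_distr id_vimage emeasure_eq_measure ennreal_mult del: vimage_ident)
qed simp

theorem theorem2:
  fixes M D :: "'w measure" and S :: "'s measure" and E :: "'e set"
    and f :: "'e \<Rightarrow> 'w \<Rightarrow> 's \<Rightarrow> real" and g :: "'e \<Rightarrow> 'w \<Rightarrow> real"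
    and \<mu> :: "'w \<Rightarrow> 's measure" and \<gamma> :: real and a :: "'e \<Rightarrow> real"
  assumes "prob_space M" and "finite E"
    and "subalgebra M D"
    \<comment> \<open>D carries the randomness of f and \<mu>; it is independent of the Gaussians\<close>
    and f_measurable: "\<And>e. e \<in> E \<Longrightarrow> (\<lambda>(\<omega>, \<sigma>). f e \<omega> \<sigma>) \<in> borel_measurable (D \<Otimes>\<^sub>M S)"
    and f_range: "\<And>e \<omega> \<sigma>. e \<in> E \<Longrightarrow> \<omega> \<in> space M \<Longrightarrow> \<sigma> \<in> space S \<Longrightarrow> f e \<omega> \<sigma> \<in> {-1..1}"
    and \<mu>_sets: "\<And>\<omega>. \<omega> \<in> space M \<Longrightarrow> sets (\<mu> \<omega>) = sets S"
    and \<mu>_finite: "\<And>\<omega>. \<omega> \<in> space M \<Longrightarrow> finite_measure (\<mu> \<omega>)"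
    and \<mu>_nonzero: "\<And>\<omega>. \<omega> \<in> space M \<Longrightarrow> emeasure (\<mu> \<omega>) (space S) \<noteq> 0"
    and \<mu>_measurable: "\<And>A. A \<in> sets S \<Longrightarrow> (\<lambda>\<omega>. emeasure (\<mu> \<omega>) A) \<in> borel_measurable D"
    and g_indep: "prob_space.indep_vars M (\<lambda>_. borel) g E"
    and g_normal: "\<And>e. e \<in> E \<Longrightarrow> distributed M lborel (g e) std_normal_density"
    and disorder_indep: "prob_space.indep_set M (sets D)
      (sets (vimage_algebra (space M) (\<lambda>\<omega>. \<lambda>e\<in>E. g e \<omega>) (\<Pi>\<^sub>M e\<in>E. borel)))"
    and "\<gamma> > 0"
  shows "prob_space.expectation M (\<lambda>\<omega>.
      let G = gibbs_measure \<gamma> (\<mu> \<omega>) (gaussian_field E (\<lambda>e. g e \<omega>) (\<lambda>e. f e \<omega>));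
          m = bond_magnetization E a (\<lambda>e. f e \<omega>)
      in \<integral>\<sigma>. (m \<sigma> - (\<integral>\<tau>. m \<tau> \<partial>G))\<^sup>2 \<partial>G)
    \<le> (1 / \<gamma>) * L2_set a E * (\<Sum>e\<in>E. \<bar>a e\<bar>)"
proof (cases "E = {}")
  \<comment> \<open>The magnetization is identically 0 and both sides vanish; the law of the
    Gaussian vector is identified below only for nonempty \<open>E\<close>.\<close>
  case True
  then show ?thesis by (simp add: bond_magnetization_def[abs_def])
next
  case False
  interpret prob_space M by fact
  note E = \<open>finite E\<close>
  have D: "space D = space M" "sets D \<subseteq> sets M" using \<open>subalgebra M D\<close> by (auto simp: subalgebra_def)
  let ?B = "\<Pi>\<^sub>M e\<in>E. (borel :: real measure)"
  let ?G = "gauss_PiM E"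
  define X where "X \<omega> = (\<lambda>e\<in>E. g e \<omega>)" for \<omega>
  define H where "H p \<sigma> = \<gamma> * gaussian_field E (snd p) (\<lambda>e. f e (fst p)) \<sigma>" for p \<sigma>
  define m where "m \<omega> = bond_magnetization E a (\<lambda>e. f e \<omega>)" for \<omega>
  \<comment> \<open>In \<open>V\<close> the Gaussian vector is a free second coordinate, decoupled
    from \<omega>. The actual Gibbs variance is its value at
    \<open>(\<omega>, X \<omega>)\<close>.\<close>
  define V where "V p = tilt_cov (\<mu> (fst p)) (H p) (m (fst p)) (m (fst p))" for p
  define C where "C = (1 / \<gamma>) * L2_set a E * (\<Sum>e\<in>E. \<bar>a e\<bar>)"
  have C: "0 \<le> C" using \<open>\<gamma> > 0\<close> by (simp add: C_def sum_nonneg)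

  have \<mu>_space: "space (\<mu> \<omega>) = space S" if "\<omega> \<in> space M" for \<omega>
    using \<mu>_sets[OF that] by (rule sets_eq_imp_space_eq)
  have \<mu>: "nonzero_finite_measure (\<mu> \<omega>)" if "\<omega> \<in> space M" for \<omega>
    using \<mu>_finite[OF that] \<mu>_nonzero[OF that]
    by (simp add: nonzero_finite_measure_def nonzero_finite_measure_axioms_def \<mu>_space[OF that])
  have f\<omega>: "f e \<omega> \<in> borel_measurable (\<mu> \<omega>)" if "e \<in> E" "\<omega> \<in> space M" for e \<omega>
    using measurable_compose[OF measurable_Pair1' f_measurable[OF that(1)]] that(2) D(1) \<mu>_sets[OF that(2)]
    by (simp cong: measurable_cong_sets)
  have f1: "\<bar>f e \<omega> \<sigma>\<bar> \<le> 1" if "e \<in> E" "\<omega> \<in> space M" "\<sigma> \<in> space (\<mu> \<omega>)" for e \<omega> \<sigma>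
    using f_range[of e \<omega> \<sigma>] that \<mu>_space by (simp add: abs_le_iff)

  have X_meas: "X \<in> measurable M ?B"
    unfolding X_def[abs_def] using distributed_measurable[OF g_normal]
    by (intro measurable_restrict) simp
  have id_meas: "(\<lambda>\<omega>. \<omega>) \<in> measurable M D"
  proof (rule measurableI)
    show "(\<lambda>\<omega>. \<omega>) -` A \<inter> space M \<in> sets M" if "A \<in> sets D" for A
      using sets.sets_into_space[OF that] that D by (auto simp: Int_absorb2 vimage_ident)
  qed (simp add: D)
  have X_distr: "distr M ?B X = ?G"
    unfolding X_def[abs_def] by (rule distr_indep_gaussians[OF False g_indep g_normal])
  have joint: "distr M D (\<lambda>\<omega>. \<omega>) \<Otimes>\<^sub>M ?G = distr M (D \<Otimes>\<^sub>M ?B) (\<lambda>\<omega>. (\<omega>, X \<omega>))"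
    using distr_pair_indep_subalgebra[OF \<open>subalgebra M D\<close> X_meas] disorder_indep
    unfolding X_distr by (simp add: X_def[abs_def])

  have f_meas: "(\<lambda>q. f e (fst (fst q)) (snd q)) \<in> borel_measurable ((D \<Otimes>\<^sub>M ?B) \<Otimes>\<^sub>M S)" if "e \<in> E" for e
  proof -
    have "(\<lambda>q. (fst (fst q), snd q)) \<in> measurable ((D \<Otimes>\<^sub>M ?B) \<Otimes>\<^sub>M S) (D \<Otimes>\<^sub>M S)"
      by measurable
    from measurable_compose[OF this f_measurable[OF that]] show ?thesis by (simp only: prod.case)
  qed
  have m_meas: "(\<lambda>q. m (fst (fst q)) (snd q)) \<in> borel_measurable ((D \<Otimes>\<^sub>M ?B) \<Otimes>\<^sub>M S)"
    unfolding m_def bond_magnetization_def using f_meas by measurable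
  have H_meas [measurable]: "(\<lambda>q. H (fst q) (snd q)) \<in> borel_measurable ((D \<Otimes>\<^sub>M ?B) \<Otimes>\<^sub>M S)"
    unfolding H_def gaussian_field_def using f_meas by measurable
  \<comment> \<open>The kernel lemma is used over the product of \<open>D\<close> with the Gaussian
    coordinates; the measure reads only the first component.\<close>
  have kernel: "(\<lambda>p. \<integral>\<sigma>. k p \<sigma> \<partial>\<mu> (fst p)) \<in> borel_measurable (D \<Otimes>\<^sub>M ?B)"
    if k: "(\<lambda>q. k (fst q) (snd q)) \<in> borel_measurable ((D \<Otimes>\<^sub>M ?B) \<Otimes>\<^sub>M S)" for k :: "_ \<Rightarrow> _ \<Rightarrow> real"
  proof (rule borel_measurable_integral_finite_kernel)
    show "case_prod k \<in> borel_measurable ((D \<Otimes>\<^sub>M ?B) \<Otimes>\<^sub>M S)"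
      using k by (simp only: case_prod_beta')
    show "(\<lambda>p. emeasure (\<mu> (fst p)) A) \<in> borel_measurable (D \<Otimes>\<^sub>M ?B)" if "A \<in> sets S" for A
      using measurable_compose[OF measurable_fst \<mu>_measurable[OF that]] .
    fix p assume "p \<in> space (D \<Otimes>\<^sub>M ?B)"
    then have "fst p \<in> space M" by (auto simp: space_pair_measure D)
    then show "sets (\<mu> (fst p)) = sets S" "nonzero_finite_measure (\<mu> (fst p))"
      by (rule \<mu>_sets, rule \<mu>)
  qed
  have avg_meas: "(\<lambda>p. tilt_avg (\<mu> (fst p)) (H p) (u p)) \<in> borel_measurable (D \<Otimes>\<^sub>M ?B)"
    if [measurable]: "(\<lambda>q. u (fst q) (snd q)) \<in> borel_measurable ((D \<Otimes>\<^sub>M ?B) \<Otimes>\<^sub>M S)" for u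
    unfolding tilt_avg_def by (intro borel_measurable_divide kernel) measurable
  have V_meas: "V \<in> borel_measurable (D \<Otimes>\<^sub>M ?B)"
    unfolding V_def[abs_def] tilt_cov_def using m_meas
    by (intro borel_measurable_diff borel_measurable_times avg_meas) auto

  have var: "(let G = gibbs_measure \<gamma> (\<mu> \<omega>) (gaussian_field E (\<lambda>e. g e \<omega>) (\<lambda>e. f e \<omega>));
          m = bond_magnetization E a (\<lambda>e. f e \<omega>)
      in \<integral>\<sigma>. (m \<sigma> - (\<integral>\<tau>. m \<tau> \<partial>G))\<^sup>2 \<partial>G) = V (\<omega>, X \<omega>)" if \<omega>: "\<omega> \<in> space M" for \<omega>
  proof -
    interpret \<mu>: nonzero_finite_measure "\<mu> \<omega>" by (rule \<mu>[OF \<omega>])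
    have bf: "bounded_borel (\<mu> \<omega>) (f e \<omega>)" if "e \<in> E" for e
      using f\<omega> f1 that \<omega> by (intro bounded_borelI)
    have "bounded_borel (\<mu> \<omega>) (m \<omega>)" "bounded_borel (\<mu> \<omega>) (gaussian_field E (\<lambda>e. g e \<omega>) (\<lambda>e. f e \<omega>))"
      unfolding m_def bond_magnetization_def[abs_def] gaussian_field_def[abs_def]
      by (intro bounded_borel_intros bf; assumption)+
    \<comment> \<open>\<open>X \<omega>\<close> agrees with the Gaussians on \<open>E\<close>, and
      the field reads only those indices.\<close>
    moreover have "gaussian_field E (X \<omega>) (\<lambda>e. f e \<omega>) = gaussian_field E (\<lambda>e. g e \<omega>) (\<lambda>e. f e \<omega>)"
      by (simp add: gaussian_field_def[abs_def] X_def)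
    ultimately show ?thesis
      using \<mu>.gibbs_variance_eq_tilt_cov by (simp add: Let_def V_def H_def[abs_def] m_def)
  qed
  have V_bound: "(\<integral>x. V (\<omega>, x) \<partial>?G) \<le> C" if \<omega>: "\<omega> \<in> space M" for \<omega>
    using nonzero_finite_measure.gauss_PiM_tilt_cov_le[OF \<mu>[OF \<omega>] E, of "\<lambda>e. f e \<omega>" \<gamma> a] f\<omega> f1 \<omega> \<open>\<gamma> > 0\<close>
    by (simp add: V_def H_def[abs_def] m_def C_def)

  let ?P = "distr M D (\<lambda>\<omega>. \<omega>)"
  interpret P: prob_space ?P by (rule prob_space_distr[OF id_meas])
  interpret G: prob_space ?G by (rule prob_space_gauss_PiM)
  interpret PG: pair_sigma_finite ?P ?G ..
  \<comment> \<open>By independence the law of \<open>(\<omega>, X \<omega>)\<close> is a product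
    measure, so the expectation becomes an integral in which \<omega> can be frozen.\<close>
  have "expectation (\<lambda>\<omega>. V (\<omega>, X \<omega>)) = (\<integral>p. V p \<partial>(?P \<Otimes>\<^sub>M ?G))"
    unfolding joint using V_meas id_meas X_meas by (subst integral_distr) auto
  also have "\<dots> \<le> C"
  proof (cases "integrable (?P \<Otimes>\<^sub>M ?G) V")
    case True
    \<comment> \<open>Fubini with the Gaussian integral inside, so that the conditional bound
      \<open>V_bound\<close> applies for each \<omega>.\<close>
    have "(\<integral>p. V p \<partial>(?P \<Otimes>\<^sub>M ?G)) = (\<integral>\<omega>. (\<integral>x. V (\<omega>, x) \<partial>?G) \<partial>?P)"
      using PG.integral_fst'[OF True] by simp
    also have "\<dots> \<le> (\<integral>\<omega>. C \<partial>?P)"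
      using V_bound PG.integrable_fst'[OF True] by (intro integral_mono) (auto simp: D)
    also have "\<dots> = C" using P.prob_space by simp
    finally show ?thesis .
  next
    \<comment> \<open>The Bochner integral of a non-integrable function is 0.\<close>
    case False
    then show ?thesis using C by (simp add: not_integrable_integral_eq)
  qed
  finally have "expectation (\<lambda>\<omega>. V (\<omega>, X \<omega>)) \<le> C" .
  then show ?thesis
    unfolding C_def by (subst Bochner_Integration.integral_cong[OF refl var])
qed

end
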